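(* Let $\mathbb G$ and $\mathbb H$ be quantum permutation groups such that $\mathbb G$ has no nonlocal symmetry and $\mathbb H$ has a commutative $C^*$-algebra $C(\mathbb H)$. Then the tensor product $\mathbb G\times\mathbb H$ has no nonlocal symmetry.
   Context: A magic unitary is a matrix $U=(u_{ij})\in M_n(\mathcal A)$ over a unital $C^*$-algebra $\mathcal A$ with $u_{ij}=u_{ij}^*=u_{ij}^2$ and $\sum_ku_{ik}=\sum_ku_{ki}=\mathbf 1$ for all $i,j$. A compact matrix quantum group is a pair $\mathbb G=(C(\mathbb G),U)$ with $C(\mathbb G)$ a unital $C^*$-algebra generated by the entries of $U=(u_{ij})\in M_n(C(\mathbb G))$ (the fundamental representation), such that there is a $*$-homomorphism $C(\mathbb G)\to C(\mathbb G)\otimes C(\mathbb G)$ (minimal tensor product) with $u_{ij}\mapsto\sum_ku_{ik}\otimes u_{kj}$, and $U$, $U^T$ are invertible. A quantum permutation group is a quantum subgroup of the quantum symmetric group $S_n^+$, i.e. a compact matrix quantum group whose fundamental representation $U$ is a magic unitary. A quantum permutation group $\mathbb G$ with fundamental representation $U\in M_n(C(\mathbb G))$ exhibits (has) nonlocal symmetry if there is a tracial state $\tau$ on $C(\mathbb G)$ such that the correlation $p(l,k|i,j)=\tau(u_{il}u_{jk})$ is nonlocal (non-classical), i.e. not a convex combination of the correlations $p_\pi$, $\pi\in S_n$, where $p_\pi(l,k|i,j)=1$ if $l=\pi(i)$ and $k=\pi(j)$, and $0$ otherwise. For $\mathbb G=(C(\mathbb G),U)$ and $\mathbb H=(C(\mathbb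 H),V)$, the tensor product is $\mathbb G\times\mathbb H=(C(\mathbb G)\otimes_{\max}C(\mathbb H),U\otimes V)$, with fundamental representation having entries $w_{ia,jb}=u_{ij}v_{ab}$; in $C(\mathbb G)\otimes_{\max}C(\mathbb H)$ the $u_{ij}$ and $v_{ab}$ commute with each other, fulfill the relations of $C(\mathbb G)$ and $C(\mathbb H)$ respectively, and $\mathbf 1_{C(\mathbb G)}=\mathbf 1_{C(\mathbb H)}$. *)

theory Defs
  imports "HOL-Analysis.Analysis"
begin

text \<open>
  Unital C*-algebras. The superclass \<^class>\<open>real_normed_algebra_1\<close> supplies the ring, the
  submultiplicative norm and \<open>norm 1 = 1\<close>, hence \<open>1 \<noteq> 0\<close>; \<^class>\<open>banach\<close> supplies completeness.
\<close>

class cstar_algebra = real_normed_algebra_1 + banach +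
  fixes scaleC :: "complex \<Rightarrow> 'a \<Rightarrow> 'a"  (infixr \<open>*\<^sub>C\<close> 75)
    and star :: "'a \<Rightarrow> 'a"
  assumes scaleC_add_right: "c *\<^sub>C (x + y) = c *\<^sub>C x + c *\<^sub>C y"
    and scaleC_add_left: "(c + d) *\<^sub>C x = c *\<^sub>C x + d *\<^sub>C x"
    and scaleC_scaleC: "c *\<^sub>C d *\<^sub>C x = (c * d) *\<^sub>C x"
    and scaleR_scaleC: "r *\<^sub>R x = complex_of_real r *\<^sub>C x"
    and mult_scaleC_left: "(c *\<^sub>C x) * y = c *\<^sub>C (x * y)"
    and mult_scaleC_right: "x * (c *\<^sub>C y) = c *\<^sub>C (x * y)"
    and norm_scaleC: "norm (c *\<^sub>C x) = cmod c * norm x"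
    and star_star: "star (star x) = x"
    and star_add: "star (x + y) = star x + star y"
    and star_scaleC: "star (c *\<^sub>C x) = cnj c *\<^sub>C star x"
    and star_mult: "star (x * y) = star y * star x"
    and cstar_identity: "norm (star x * x) = (norm x)\<^sup>2"

global_interpretation complex_vector: vector_space "scaleC :: complex \<Rightarrow> 'a \<Rightarrow> 'a::cstar_algebra"
proof
  fix x :: 'a
  have "1 *\<^sub>R x = complex_of_real 1 *\<^sub>C x" by (rule scaleR_scaleC)
  then show "1 *\<^sub>C x = x" by simp
qed (simp_all add: scaleC_add_right scaleC_add_left scaleC_scaleC)

definition star_hom :: "('a::cstar_algebra \<Rightarrow> 'b::cstar_algebra) \<Rightarrow> bool" where
  "star_hom f \<longleftrightarrow>
     Vector_Spaces.linear scaleC scaleC f \<and>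
     (\<forall>x y. f (x * y) = f x * f y) \<and>
     (\<forall>x. f (star x) = star (f x))"

definition unital_star_subalgebra :: "'a::cstar_algebra set \<Rightarrow> bool" where
  "unital_star_subalgebra S \<longleftrightarrow>
     complex_vector.subspace S \<and> 1 \<in> S \<and>
     (\<forall>x\<in>S. \<forall>y\<in>S. x * y \<in> S) \<and>
     (\<forall>x\<in>S. star x \<in> S)"

definition generated_cstar_subalgebra :: "'a::cstar_algebra set \<Rightarrow> 'a set" where
  "generated_cstar_subalgebra X = (\<lambda>S. unital_star_subalgebra S \<and> closed S) hull X"

definition tracial_state :: "('a::cstar_algebra \<Rightarrow> complex) \<Rightarrow> bool" where
  "tracial_state \<tau> \<longleftrightarrow>
     Vector_Spaces.linear scaleC (*) \<tau> \<and>
     (\<forall>x. \<tau> (star x * x) \<in> \<real>\<^sub>\<ge>\<^sub>0) \<and>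
     \<tau> 1 = 1 \<and>
     (\<forall>x y. \<tau> (x * y) = \<tau> (y * x))"

text \<open>
  A C*-norm on a *-subalgebra \<open>S\<close>, which is in general different from the restriction of the
  ambient norm and need not be complete.
\<close>

definition cstar_norm_on :: "'a::cstar_algebra set \<Rightarrow> ('a \<Rightarrow> real) \<Rightarrow> bool" where
  "cstar_norm_on S \<gamma> \<longleftrightarrow>
     (\<forall>x\<in>S. 0 \<le> \<gamma> x) \<and>
     (\<forall>x\<in>S. \<gamma> x = 0 \<longrightarrow> x = 0) \<and>
     (\<forall>x\<in>S. \<forall>c. \<gamma> (c *\<^sub>C x) = cmod c * \<gamma> x) \<and>
     (\<forall>x\<in>S. \<forall>y\<in>S. \<gamma> (x + y) \<le> \<gamma> x + \<gamma> y) \<and>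
     (\<forall>x\<in>S. \<forall>y\<in>S. \<gamma> (x * y) \<le> \<gamma> x * \<gamma> y) \<and>
     (\<forall>x\<in>S. \<gamma> (star x * x) = (\<gamma> x)\<^sup>2)"

text \<open>
  C*-tensor products, described up to isomorphism: \<open>t a b\<close> plays the role of the elementary
  tensor of \<open>a\<close> and \<open>b\<close> inside the C*-algebra \<open>'c\<close>. The injectivity clause says that the linear
  map induced by \<open>t\<close> on the algebraic tensor product of \<open>'a\<close> and \<open>'b\<close> is injective, so that
  \<open>algebraic_part t\<close> is a copy of the algebraic tensor product as a *-algebra. Hence \<open>'c\<close> is its
  completion in the C*-norm obtained by restricting the norm of \<open>'c\<close>.
\<close>

definition algebraic_part ::
    "('a::cstar_algebra \<Rightarrow> 'b::cstar_algebra \<Rightarrow> 'c::cstar_algebra) \<Rightarrow> 'c set" where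
  "algebraic_part t = complex_vector.span {t a b |a b. True}"

definition cstar_tensor_product ::
    "('a::cstar_algebra \<Rightarrow> 'b::cstar_algebra \<Rightarrow> 'c::cstar_algebra) \<Rightarrow> bool" where
  "cstar_tensor_product t \<longleftrightarrow>
     (\<forall>a. Vector_Spaces.linear scaleC scaleC (\<lambda>b. t a b)) \<and>
     (\<forall>b. Vector_Spaces.linear scaleC scaleC (\<lambda>a. t a b)) \<and>
     (\<forall>a a' b b'. t a b * t a' b' = t (a * a') (b * b')) \<and>
     (\<forall>a b. star (t a b) = t (star a) (star b)) \<and>
     t 1 1 = 1 \<and>
     (\<forall>S f. finite S \<and> \<not> complex_vector.dependent S \<and> (\<Sum>a\<in>S. t a (f a)) = 0
        \<longrightarrow> (\<forall>a\<in>S. f a = 0)) \<and>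
     closure (algebraic_part t) = UNIV"

text \<open>
  The minimal and the maximal tensor product are the completions of the algebraic tensor product
  in its least and its greatest C*-norm, respectively.
\<close>

definition min_tensor_product ::
    "('a::cstar_algebra \<Rightarrow> 'b::cstar_algebra \<Rightarrow> 'c::cstar_algebra) \<Rightarrow> bool" where
  "min_tensor_product t \<longleftrightarrow>
     cstar_tensor_product t \<and>
     (\<forall>\<gamma>. cstar_norm_on (algebraic_part t) \<gamma> \<longrightarrow> (\<forall>x\<in>algebraic_part t. norm x \<le> \<gamma> x))"

definition max_tensor_product ::
    "('a::cstar_algebra \<Rightarrow> 'b::cstar_algebra \<Rightarrow> 'c::cstar_algebra) \<Rightarrow> bool" where
  "max_tensor_product t \<longleftrightarrow>
     cstar_tensor_product t \<and>
     (\<forall>\<gamma>. cstar_norm_on (algebraic_part t) \<gamma> \<longrightarrow> (\<forall>x\<in>algebraic_part t. \<gamma> x \<le> norm x))"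

definition magic_unitary :: "'a::cstar_algebra ^ 'n ^ 'n \<Rightarrow> bool" where
  "magic_unitary U \<longleftrightarrow>
     (\<forall>i j. star (U $ i $ j) = U $ i $ j \<and> (U $ i $ j)\<^sup>2 = U $ i $ j) \<and>
     (\<forall>i. (\<Sum>k\<in>UNIV. U $ i $ k) = 1 \<and> (\<Sum>k\<in>UNIV. U $ k $ i) = 1)"

text \<open>
  The C*-algebra of functions on the quantum group is the whole type \<open>'a\<close>. The argument \<open>t\<close> is a
  model of the minimal tensor product of \<open>'a\<close> with itself, in which the comultiplication \<open>\<Delta>\<close>
  takes its values; since such models are canonically isomorphic, the choice of \<open>t\<close> is immaterial.
\<close>

definition compact_matrix_quantum_group ::
    "('a::cstar_algebra \<Rightarrow> 'a \<Rightarrow> 'c::cstar_algebra) \<Rightarrow> 'a ^ 'n ^ 'n \<Rightarrow> bool" where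
  "compact_matrix_quantum_group t U \<longleftrightarrow>
     generated_cstar_subalgebra {U $ i $ j |i j. True} = UNIV \<and>
     min_tensor_product t \<and>
     (\<exists>\<Delta>. star_hom \<Delta> \<and> (\<forall>i j. \<Delta> (U $ i $ j) = (\<Sum>k\<in>UNIV. t (U $ i $ k) (U $ k $ j)))) \<and>
     invertible U \<and> invertible (transpose U)"

definition quantum_permutation_group ::
    "('a::cstar_algebra \<Rightarrow> 'a \<Rightarrow> 'c::cstar_algebra) \<Rightarrow> 'a ^ 'n ^ 'n \<Rightarrow> bool" where
  "quantum_permutation_group t U \<longleftrightarrow> compact_matrix_quantum_group t U \<and> magic_unitary U"

text \<open>
  Correlations \<open>p(l,k|i,j)\<close> are functions \<open>p l k i j\<close>. They are complex-valued so that no real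
  part needs to be taken of the values of a trace.
\<close>

type_synonym 'n correlation = "'n \<Rightarrow> 'n \<Rightarrow> 'n \<Rightarrow> 'n \<Rightarrow> complex"

definition permutation_correlation :: "('n \<Rightarrow> 'n) \<Rightarrow> 'n correlation" where
  "permutation_correlation \<pi> l k i j = (if l = \<pi> i \<and> k = \<pi> j then 1 else 0)"

definition local_correlation :: "'n::finite correlation \<Rightarrow> bool" where
  "local_correlation p \<longleftrightarrow>
     (\<exists>c :: ('n \<Rightarrow> 'n) \<Rightarrow> real.
        (\<forall>\<pi>\<in>{\<pi>. bij \<pi>}. 0 \<le> c \<pi>) \<and> (\<Sum>\<pi> | bij \<pi>. c \<pi>) = 1 \<and>
        (\<forall>l k i j. p l k i j = (\<Sum>\<pi> | bij \<pi>. of_real (c \<pi>) * permutation_correlation \<pi> l k i j)))"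

definition trace_correlation ::
    "('a::cstar_algebra \<Rightarrow> complex) \<Rightarrow> 'a ^ 'n ^ 'n \<Rightarrow> 'n correlation" where
  "trace_correlation \<tau> U l k i j = \<tau> (U $ i $ l * U $ j $ k)"

definition has_nonlocal_symmetry :: "'a::cstar_algebra ^ 'n ^ 'n \<Rightarrow> bool" where
  "has_nonlocal_symmetry U \<longleftrightarrow>
     (\<exists>\<tau>. tracial_state \<tau> \<and> \<not> local_correlation (trace_correlation \<tau> U))"

text \<open>
  The fundamental representation \<open>w\<^sub>i\<^sub>a\<^sub>,\<^sub>j\<^sub>b = u\<^sub>i\<^sub>j v\<^sub>a\<^sub>b\<close> of the tensor product of two compact matrix
  quantum groups; its index set is the product of the two index sets.
\<close>

definition tensor_representation ::
    "('a \<Rightarrow> 'b \<Rightarrow> 'c) \<Rightarrow> 'a ^ 'n ^ 'n \<Rightarrow> 'b ^ 'm ^ 'm \<Rightarrow> 'c ^ ('n \<times> 'm) ^ ('n \<times> 'm)" where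
  "tensor_representation t U V = (\<chi> p q. t (U $ fst p $ fst q) (V $ snd p $ snd q))"

end

theory Submission
  imports Defs
begin

text \<open>
  Since \<open>C(H)\<close> is commutative, \<open>1 \<in> C(H)\<close> is a sum of projections \<open>x\<close> below which \<open>V\<close> is a
  permutation matrix \<open>\<sigma>\<close>. Slicing a trace \<open>\<tau>\<close> of the tensor product by such an \<open>x\<close> gives the
  positive trace \<open>a \<mapsto> \<tau> (a \<otimes> x)\<close> on \<open>C(G)\<close>, whose correlation is a nonnegative combination of
  the \<open>p\<^sub>\<pi>\<close> by assumption. Hence the correlation of \<open>\<tau>\<close> is a nonnegative combination of the
  \<open>p\<^sub>\<pi>\<^sub>\<times>\<^sub>\<sigma>\<close>, and the weights sum to \<open>\<tau> 1 = 1\<close>.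
\<close>

section \<open>The cone spanned by the permutation correlations\<close>

text \<open>The total weight is left free, so that zero, sums and nonnegative multiples stay in the
  cone and normalization is settled once at the end.\<close>

definition local_cone :: "'n::finite correlation \<Rightarrow> bool" where
  "local_cone p \<longleftrightarrow>
     (\<exists>c :: ('n \<Rightarrow> 'n) \<Rightarrow> real. (\<forall>\<pi>. 0 \<le> c \<pi>) \<and>
        (\<forall>l k i j. p l k i j = (\<Sum>\<pi> | bij \<pi>. of_real (c \<pi>) * permutation_correlation \<pi> l k i j)))"

lemma local_cone_zero: "local_cone (\<lambda>l k i j. 0)"
  unfolding local_cone_def by (rule exI[of _ "\<lambda>_. 0"]) simp

lemma local_cone_add:
  assumes "local_cone p" "local_cone q"
  shows "local_cone (\<lambda>l k i j. p l k i j + q l k i j)"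
proof -
  obtain c d where "\<forall>\<pi>. 0 \<le> c \<pi>" "\<forall>\<pi>. 0 \<le> d \<pi>"
    and "\<And>l k i j. p l k i j = (\<Sum>\<pi> | bij \<pi>. of_real (c \<pi>) * permutation_correlation \<pi> l k i j)"
    and "\<And>l k i j. q l k i j = (\<Sum>\<pi> | bij \<pi>. of_real (d \<pi>) * permutation_correlation \<pi> l k i j)"
    using assms unfolding local_cone_def by blast
  then show ?thesis
    unfolding local_cone_def
    by (intro exI[of _ "\<lambda>\<pi>. c \<pi> + d \<pi>"]) (simp add: sum.distrib distrib_right)
qed

lemma local_cone_sum:
  assumes "\<And>s. s \<in> S \<Longrightarrow> local_cone (p s)"
  shows "local_cone (\<lambda>l k i j. \<Sum>s\<in>S. p s l k i j)"
  using assms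
  by (induction S rule: infinite_finite_induct) (simp_all add: local_cone_zero local_cone_add)

lemma local_cone_permutation_correlation:
  assumes "bij \<pi>" "0 \<le> r"
  shows "local_cone (\<lambda>l k i j. of_real r * permutation_correlation \<pi> l k i j)"
proof -
  have "(\<Sum>\<rho> | bij \<rho>. of_real (if \<rho> = \<pi> then r else 0) * permutation_correlation \<rho> l k i j)
      = of_real r * permutation_correlation \<pi> l k i j" for l k i j
    using assms by (subst sum.remove[of _ \<pi>]) (auto intro!: sum.neutral)
  then show ?thesis
    unfolding local_cone_def using assms by (intro exI[of _ "\<lambda>\<rho>. if \<rho> = \<pi> then r else 0"]) simp
qed

lemma local_correlation_imp_local_cone_scale:
  assumes "local_correlation p" "0 \<le> r"
  shows "local_cone (\<lambda>l k i j. of_real r * p l k i j)"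
proof -
  obtain c where c: "\<forall>\<pi>\<in>{\<pi>. bij \<pi>}. 0 \<le> c \<pi>"
    and p: "\<And>l k i j. p l k i j = (\<Sum>\<pi> | bij \<pi>. of_real (c \<pi>) * permutation_correlation \<pi> l k i j)"
    using assms(1) unfolding local_correlation_def by blast
  \<comment> \<open>Here \<open>c\<close> is known to be nonnegative on bijections only, so the sum
    is assembled from single permutations instead of offering \<open>r * c\<close> as a
    witness.\<close>
  have "local_cone (\<lambda>l k i j. \<Sum>\<pi> | bij \<pi>. of_real (r * c \<pi>) * permutation_correlation \<pi> l k i j)"
    using c assms(2) by (intro local_cone_sum local_cone_permutation_correlation) auto
  then show ?thesis by (simp add: p sum_distrib_left mult.assoc)
qed

lemma permutation_correlation_map_prod:
  "permutation_correlation (map_prod \<pi> \<sigma>) l k i j =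
     permutation_correlation \<pi> (fst l) (fst k) (fst i) (fst j) *
     permutation_correlation \<sigma> (snd l) (snd k) (snd i) (snd j)"
  by (auto simp: permutation_correlation_def prod_eq_iff)

text \<open>Multiplying by the correlation of \<open>\<sigma>\<close> replaces each
  \<open>\<pi>\<close> by \<open>map_prod \<pi> \<sigma>\<close>, again a bijection, and keeps its
  weight.\<close>

lemma local_cone_times_permutation:
  assumes "local_cone p" "bij \<sigma>"
  shows "local_cone (\<lambda>l k i j. p (fst l) (fst k) (fst i) (fst j) *
           permutation_correlation \<sigma> (snd l) (snd k) (snd i) (snd j))"
proof -
  obtain c where c: "\<forall>\<pi>. 0 \<le> c \<pi>"
    and p: "\<And>l k i j. p l k i j = (\<Sum>\<pi> | bij \<pi>. of_real (c \<pi>) * permutation_correlation \<pi> l k i j)"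
    using assms(1) unfolding local_cone_def by blast
  have "local_cone (\<lambda>l k i j. \<Sum>\<pi> | bij \<pi>.
          of_real (c \<pi>) * permutation_correlation (map_prod \<pi> \<sigma>) l k i j)"
    using c assms(2)
    by (intro local_cone_sum local_cone_permutation_correlation)
       (auto simp: bij_def prod.inj_map map_prod_surj)
  then show ?thesis
    by (simp add: p permutation_correlation_map_prod sum_distrib_right mult.assoc)
qed

text \<open>Each permutation correlation has total mass 1 over the outputs \<open>l\<close>,
  \<open>k\<close>, so a single input pair \<open>i\<close>, \<open>j\<close> already reveals the
  sum of all weights.\<close>

lemma local_cone_normalized:
  fixes p :: "'n::finite correlation"
  assumes "local_cone p" and "(\<Sum>l\<in>UNIV. \<Sum>k\<in>UNIV. p l k i j) = 1"
  shows "local_correlation p"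
proof -
  obtain c where c: "\<forall>\<pi>. 0 \<le> c \<pi>"
    and p: "\<And>l k i j. p l k i j = (\<Sum>\<pi> | bij \<pi>. of_real (c \<pi>) * permutation_correlation \<pi> l k i j)"
    using assms(1) unfolding local_cone_def by blast
  have one: "(\<Sum>l\<in>UNIV. \<Sum>k\<in>UNIV. permutation_correlation \<pi> l k i j) = 1" for \<pi> :: "'n \<Rightarrow> 'n"
  proof -
    have "(\<Sum>k\<in>UNIV. permutation_correlation \<pi> l k i j) = (if l = \<pi> i then 1 else 0)" for l
      by (cases "l = \<pi> i") (simp_all add: permutation_correlation_def)
    then show ?thesis by simp
  qed
  have "(\<Sum>l\<in>UNIV. \<Sum>k\<in>UNIV. p l k i j) = (\<Sum>l\<in>UNIV. \<Sum>\<pi> | bij \<pi>. \<Sum>k\<in>UNIV.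
          of_real (c \<pi>) * permutation_correlation \<pi> l k i j)"
    unfolding p by (intro sum.cong refl sum.swap)
  also have "\<dots> = (\<Sum>\<pi> | bij \<pi>. of_real (c \<pi>) *
      (\<Sum>l\<in>UNIV. \<Sum>k\<in>UNIV. permutation_correlation \<pi> l k i j))"
    by (subst sum.swap) (simp add: sum_distrib_left)
  finally have "complex_of_real (\<Sum>\<pi> | bij \<pi>. c \<pi>) = 1"
    using assms(2) by (simp add: one)
  then have "(\<Sum>\<pi> | bij \<pi>. c \<pi>) = 1" using of_real_eq_1_iff by blast
  with c p show ?thesis unfolding local_correlation_def by blast
qed

section \<open>Positive traces and their correlations\<close>

lemma star_one: "star 1 = (1::'a::cstar_algebra)"
  by (metis mult_1_left mult_1_right star_mult star_star)

text \<open>A tracial state up to scaling. The value at \<open>1\<close> is free because a slice of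
  a trace by a projection can have any mass, even zero.\<close>

definition positive_trace :: "('a::cstar_algebra \<Rightarrow> complex) \<Rightarrow> bool" where
  "positive_trace \<phi> \<longleftrightarrow>
     Vector_Spaces.linear scaleC (*) \<phi> \<and>
     (\<forall>x. \<phi> (star x * x) \<in> \<real>\<^sub>\<ge>\<^sub>0) \<and>
     (\<forall>x y. \<phi> (x * y) = \<phi> (y * x))"

lemma tracial_state_iff: "tracial_state \<tau> \<longleftrightarrow> positive_trace \<tau> \<and> \<tau> 1 = 1"
  unfolding tracial_state_def positive_trace_def by blast

text \<open>By the trace property \<open>p * q\<close> may be replaced by \<open>p * q * p\<close>,
  which has the form \<open>star y * y\<close> with \<open>y = q * p\<close>.\<close>

lemma positive_trace_projections_nonneg:
  assumes "positive_trace \<phi>" "star p = p" "p * p = p" "star q = q" "q * q = q"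
  shows "\<phi> (p * q) \<in> \<real>\<^sub>\<ge>\<^sub>0"
proof -
  have "\<phi> (p * q) = \<phi> (p * p * q)" using assms(3) by simp
  also have "\<dots> = \<phi> (p * (p * q))" by (simp add: mult.assoc)
  also have "\<dots> = \<phi> (p * q * p)" using assms(1) unfolding positive_trace_def by blast
  also have "p * q * p = star (q * p) * (q * p)"
    using assms(2,4,5) by (metis mult.assoc star_mult)
  finally show ?thesis using assms(1) unfolding positive_trace_def by metis
qed

lemma sum_trace_correlation:
  fixes W :: "'a::cstar_algebra ^ 'n ^ 'n"
  assumes "Vector_Spaces.linear scaleC (*) \<phi>" and "\<And>i. (\<Sum>k\<in>UNIV. W $ i $ k) = 1"
  shows "(\<Sum>l\<in>UNIV. \<Sum>k\<in>UNIV. trace_correlation \<phi> W l k i j) = \<phi> 1"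
proof -
  interpret \<phi>: Vector_Spaces.linear scaleC "(*)" \<phi> by fact
  have "(\<Sum>l\<in>UNIV. \<Sum>k\<in>UNIV. trace_correlation \<phi> W l k i j)
      = \<phi> ((\<Sum>l\<in>UNIV. W $ i $ l) * (\<Sum>k\<in>UNIV. W $ j $ k))"
    by (simp add: trace_correlation_def \<phi>.sum sum_product)
  then show ?thesis by (simp add: assms(2))
qed

text \<open>If \<open>\<phi> 1\<close> is nonzero, dividing by it gives a tracial state. Otherwise,
  for each input pair, the values are nonnegative numbers with sum \<open>\<phi> 1 = 0\<close>, so
  all of them vanish.\<close>

lemma positive_trace_local_cone:
  fixes U :: "'a::cstar_algebra ^ 'n ^ 'n"
  assumes U: "magic_unitary U" and loc: "\<not> has_nonlocal_symmetry U" and \<phi>: "positive_trace \<phi>"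
  shows "local_cone (trace_correlation \<phi> U)"
proof (cases "\<phi> 1 = 0")
  case True
  have nonneg: "trace_correlation \<phi> U l k i j \<in> \<real>\<^sub>\<ge>\<^sub>0" for l k i j
    unfolding trace_correlation_def using U
    by (intro positive_trace_projections_nonneg \<phi>) (simp_all add: magic_unitary_def power2_eq_square)
  have "trace_correlation \<phi> U l k i j = 0" for l k i j
  proof -
    have Re_nonneg: "0 \<le> Re (trace_correlation \<phi> U l k i j)" for l k
      using nonneg by (simp add: complex_nonneg_Reals_iff)
    have "(\<Sum>l\<in>UNIV. \<Sum>k\<in>UNIV. trace_correlation \<phi> U l k i j) = 0"
      using sum_trace_correlation[of \<phi> U i j] \<phi> U True
      unfolding positive_trace_def magic_unitary_def by simp
    from arg_cong[OF this, of Re]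
    have "(\<Sum>l\<in>UNIV. \<Sum>k\<in>UNIV. Re (trace_correlation \<phi> U l k i j)) = 0" by simp
    then have "Re (trace_correlation \<phi> U l k i j) = 0"
      by (simp add: sum_nonneg_eq_0_iff sum_nonneg Re_nonneg)
    then show ?thesis using nonneg by (simp add: complex_nonneg_Reals_iff complex_eq_iff)
  qed
  then have "trace_correlation \<phi> U = (\<lambda>l k i j. 0)" by blast
  then show ?thesis using local_cone_zero by metis
next
  case False
  have "\<phi> 1 \<in> \<real>\<^sub>\<ge>\<^sub>0" using positive_trace_projections_nonneg[OF \<phi>, of 1 1] by (simp add: star_one)
  then obtain r where r: "\<phi> 1 = of_real r" "0 \<le> r" by (auto elim: nonneg_Reals_cases)
  define \<tau> where "\<tau> x = \<phi> x / of_real r" for x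
  have "tracial_state \<tau>"
    using \<phi> False r unfolding tracial_state_def positive_trace_def \<tau>_def
    by (auto simp: Vector_Spaces.linear_iff add_divide_distrib intro!: nonneg_Reals_divide_I)
  then have "local_correlation (trace_correlation \<tau> U)"
    using loc unfolding has_nonlocal_symmetry_def by blast
  then have "local_cone (\<lambda>l k i j. of_real r * trace_correlation \<tau> U l k i j)"
    using r(2) by (rule local_correlation_imp_local_cone_scale)
  moreover have "of_real r * trace_correlation \<tau> U l k i j = trace_correlation \<phi> U l k i j"
    for l k i j using False r(1) by (simp add: trace_correlation_def \<tau>_def)
  ultimately show ?thesis by simp
qed

text \<open>Because \<open>x\<close> is a projection, \<open>a \<mapsto> t a x\<close> is linear,
  multiplicative and star-preserving, so positivity and the trace property pull back along
  it.\<close>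

lemma positive_trace_slice:
  assumes t: "cstar_tensor_product t" and \<tau>: "positive_trace \<tau>"
    and x: "star x = x" "x * x = x"
  shows "positive_trace (\<lambda>a. \<tau> (t a x))"
  unfolding positive_trace_def
proof (intro conjI allI)
  have lin: "Vector_Spaces.linear scaleC scaleC (\<lambda>a. t a x)"
    and tensor_mult: "t a b * t a' b' = t (a * a') (b * b')"
    and tensor_star: "star (t a b) = t (star a) (star b)" for a a' b b'
    using t unfolding cstar_tensor_product_def by simp_all
  show "Vector_Spaces.linear scaleC (*) (\<lambda>a. \<tau> (t a x))"
    using lin \<tau> unfolding positive_trace_def by (simp add: Vector_Spaces.linear_iff)
  have mult: "t (a * b) x = t a x * t b x" for a b by (simp add: tensor_mult x)
  have star: "t (star a) x = star (t a x)" for a by (simp add: tensor_star x)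
  show "\<tau> (t (star a * a) x) \<in> \<real>\<^sub>\<ge>\<^sub>0" for a
    using \<tau> unfolding positive_trace_def mult star by blast
  show "\<tau> (t (a * b) x) = \<tau> (t (b * a) x)" for a b
    using \<tau> unfolding positive_trace_def mult by blast
qed

section \<open>Commuting idempotents and magic unitaries with commuting entries\<close>

text \<open>An algebraic substitute for positivity: a sum of commuting idempotents has no negative
  eigenvalue. Multiplying the equation by \<open>p j\<close> gives the same equation for
  \<open>p j * x\<close> over the smaller index set, with \<open>r + 1\<close> for \<open>r\<close>.
  Hence \<open>p j * x = 0\<close>, and the term of \<open>j\<close> drops out.\<close>

lemma commuting_idempotents_sum_eq_negative:
  fixes p :: "'i \<Rightarrow> 'a::real_algebra_1"
  assumes "finite I" "\<And>x y :: 'a. x * y = y * x" "\<And>i. i \<in> I \<Longrightarrow> p i * p i = p i"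
    and "0 < r" and "(\<Sum>i\<in>I. p i * x) = - (r *\<^sub>R x)"
  shows "x = 0"
  using assms(1,3-)
proof (induction I arbitrary: x r rule: finite_induct)
  case empty
  then show ?case by simp
next
  case (insert j I)
  have swap: "p i * (p j * x) = p j * (p i * x)" for i
    by (metis assms(2) mult.assoc)
  have pj: "p j * (p j * x) = p j * x"
    using insert.prems(1)[of j] by (simp flip: mult.assoc)
  have sum: "p j * x + (\<Sum>i\<in>I. p i * x) = - (r *\<^sub>R x)"
    using insert.prems(3) insert.hyps by simp
  then have "p j * (p j * x) + p j * (\<Sum>i\<in>I. p i * x) = - (r *\<^sub>R (p j * x))"
    by (metis distrib_left mult_minus_right mult_scaleR_right)
  moreover have "p j * (\<Sum>i\<in>I. p i * x) = (\<Sum>i\<in>I. p i * (p j * x))"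
    unfolding sum_distrib_left by (intro sum.cong refl swap[symmetric])
  ultimately have "(\<Sum>i\<in>I. p i * (p j * x)) = - (r *\<^sub>R (p j * x)) - p j * x"
    by (metis pj add_diff_cancel_left')
  then have "(\<Sum>i\<in>I. p i * (p j * x)) = - ((r + 1) *\<^sub>R (p j * x))"
    by (simp add: scaleR_add_left)
  then have "p j * x = 0"
    using insert.IH[of "r + 1" "p j * x"] insert.prems(1,2) by simp
  then show ?case
    using insert.IH[of r x] insert.prems(1,2) sum by simp
qed

text \<open>The product \<open>?x\<close> is fixed by both \<open>p a\<close> and
  \<open>p b\<close>, so expanding \<open>1 * ?x\<close> counts it twice. The remaining idempotents
  must then sum to -1 on \<open>?x\<close>, which forces \<open>?x = 0\<close>.\<close>

lemma commuting_idempotents_orthogonal: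
  fixes p :: "'i::finite \<Rightarrow> 'a::real_algebra_1"
  assumes comm: "\<And>x y :: 'a. x * y = y * x" and idem: "\<And>i. p i * p i = p i"
    and sum: "(\<Sum>i\<in>UNIV. p i) = 1" and "a \<noteq> b"
  shows "p a * p b = 0"
proof -
  let ?x = "p a * p b"
  have pa: "p a * ?x = ?x" using idem by (simp flip: mult.assoc)
  have pb: "p b * ?x = ?x" using idem comm by (metis mult.assoc)
  have "?x = (\<Sum>i\<in>UNIV. p i * ?x)" using sum by (simp flip: sum_distrib_right)
  also have "\<dots> = p a * ?x + (p b * ?x + (\<Sum>i\<in>UNIV - {a} - {b}. p i * ?x))"
    using \<open>a \<noteq> b\<close> by (simp add: sum.remove[of UNIV a] sum.remove[of "UNIV - {a}" b])
  finally have "?x = ?x + (?x + (\<Sum>i\<in>UNIV - {a} - {b}. p i * ?x))"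
    by (simp only: pa pb)
  then have "(\<Sum>i\<in>UNIV - {a} - {b}. p i * ?x) = - (1 *\<^sub>R ?x)"
    by (simp add: add_eq_0_iff)
  then show ?thesis
    by (intro commuting_idempotents_sum_eq_negative[of "UNIV - {a} - {b}" p 1] comm idem) simp_all
qed

text \<open>
  The induction below cuts a projection \<open>x\<close> by the rows of \<open>V\<close> one at a time; after all rows have
  been used, each piece is a projection below which \<open>V\<close> is a permutation matrix, or \<open>0\<close>.
\<close>

lemma commutative_magic_unitary_induct:
  fixes V :: "'b::cstar_algebra ^ 'm ^ 'm"
  assumes V: "magic_unitary V" and comm: "\<And>x y :: 'b. x * y = y * x"
    and zero: "P 0" and add: "\<And>x y. P x \<Longrightarrow> P y \<Longrightarrow> P (x + y)"
    and perm: "\<And>x \<sigma>. star x = x \<Longrightarrow> x * x = x \<Longrightarrow> bij \<sigma> \<Longrightarrow>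
      (\<And>a c. V $ a $ c * x = (if c = \<sigma> a then x else 0)) \<Longrightarrow> P x"
  shows "P 1"
proof -
  have idem: "V $ a $ c * V $ a $ c = V $ a $ c" and star: "star (V $ a $ c) = V $ a $ c" for a c
    using V unfolding magic_unitary_def by (simp_all add: power2_eq_square)
  have row_sum: "(\<Sum>c\<in>UNIV. V $ a $ c) = 1" and col_sum: "(\<Sum>a\<in>UNIV. V $ a $ c) = 1" for a c
    using V unfolding magic_unitary_def by simp_all
  have row: "V $ a $ c * V $ a $ d = 0" if "c \<noteq> d" for a c d
    using commuting_idempotents_orthogonal[of "\<lambda>c. V $ a $ c", OF comm idem row_sum that] .
  have col: "V $ a $ c * V $ b $ c = 0" if "a \<noteq> b" for a b c
    using commuting_idempotents_orthogonal[of "\<lambda>a. V $ a $ c", OF comm idem col_sum that] .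
  have sum: "finite S \<Longrightarrow> (\<And>s. s \<in> S \<Longrightarrow> P (g s)) \<Longrightarrow> P (\<Sum>s\<in>S. g s)" for S :: "'m set" and g
    by (induction S rule: finite_induct) (simp_all add: zero add)
  \<comment> \<open>\<open>A\<close> holds the rows still to be cut; outside \<open>A\<close>,
    \<open>f a\<close> is the column whose entry in row \<open>a\<close> already fixes
    \<open>x\<close>.\<close>
  have "P x" if "finite A" "star x = x" "x * x = x" "\<And>a. a \<notin> A \<Longrightarrow> V $ a $ f a * x = x" for A x f
    using that
  proof (induction A arbitrary: x f rule: finite_induct)
    case empty
    show ?case
    proof (cases "bij f")
      case True
      \<comment> \<open>For \<open>c \<noteq> f a\<close>, insert \<open>V $ a $ f a\<close> in
        front of \<open>x\<close>; orthogonality within row \<open>a\<close> gives zero.\<close>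
      have "V $ a $ c * x = (if c = f a then x else 0)" for a c
        using empty(3)[of a] row[of c "f a" a] by (auto simp flip: mult.assoc) (metis mult.assoc mult_zero_left)
      then show ?thesis using perm empty True by blast
    next
      case False
      then have "\<not> inj f" using finite_UNIV_inj_surj[of f] by (auto simp: bij_def)
      then obtain a b where "a \<noteq> b" "f a = f b" by (auto simp: inj_def)
      \<comment> \<open>Both entries fix \<open>x\<close>, yet they lie in one column and annihilate
        each other.\<close>
      then have "V $ a $ f a * (V $ b $ f b * x) = 0"
        using col[of a b] by (simp flip: mult.assoc)
      then have "x = 0" using empty(3) by simp
      then show ?thesis using zero by simp
    qed
  next
    case (insert b A)
    \<comment> \<open>Row \<open>b\<close> sums to 1 and so splits \<open>x\<close> into these
      pieces; the piece of \<open>c\<close> records the choice of column \<open>c\<close> for row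
      \<open>b\<close>.\<close>
    have "P (V $ b $ c * x)" for c
    proof (rule insert.IH[of _ "f(b := c)"])
      show "star (V $ b $ c * x) = V $ b $ c * x"
        by (metis comm insert.prems(1) star star_mult)
      show "V $ b $ c * x * (V $ b $ c * x) = V $ b $ c * x"
        by (metis comm idem insert.prems(2) mult.assoc)
      show "V $ a $ (f(b := c)) a * (V $ b $ c * x) = V $ b $ c * x" if "a \<notin> A" for a
      proof (cases "a = b")
        case True
        then show ?thesis using idem by (simp flip: mult.assoc)
      next
        case False
        then show ?thesis
          using insert.prems(3)[of a] that by simp (metis comm mult.assoc)
      qed
    qed
    then have "P (\<Sum>c\<in>UNIV. V $ b $ c * x)" by (intro sum) simp_all
    then show ?case by (simp add: row_sum flip: sum_distrib_right)
  qed
  \<comment> \<open>With every row still uncut, the condition on \<open>f\<close> is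
    vacuous.\<close>
  from this[of UNIV] show ?thesis by (simp add: star_one)
qed

section \<open>Correlations of the tensor product\<close>

theorem proposition5p12:
  fixes U :: "'a::cstar_algebra ^ 'n ^ 'n"
    and V :: "'b::cstar_algebra ^ 'm ^ 'm"
    and tensor_G :: "'a \<Rightarrow> 'a \<Rightarrow> 'c::cstar_algebra"
    and tensor_H :: "'b \<Rightarrow> 'b \<Rightarrow> 'd::cstar_algebra"
    and tensor_GH :: "'a \<Rightarrow> 'b \<Rightarrow> 'e::cstar_algebra"
  assumes "quantum_permutation_group tensor_G U"
    and "quantum_permutation_group tensor_H V"
    and "\<not> has_nonlocal_symmetry U"
    and "\<forall>x y :: 'b. x * y = y * x"
    and "max_tensor_product tensor_GH"
  shows "\<not> has_nonlocal_symmetry (tensor_representation tensor_GH U V)"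
proof -
  let ?W = "tensor_representation tensor_GH U V"
  have U: "magic_unitary U" and V: "magic_unitary V"
    using assms(1,2) unfolding quantum_permutation_group_def by simp_all
  have t: "cstar_tensor_product tensor_GH"
    using assms(5) unfolding max_tensor_product_def by simp
  then have lin_right: "Vector_Spaces.linear scaleC scaleC (\<lambda>b. tensor_GH a b)"
    and lin_left: "Vector_Spaces.linear scaleC scaleC (\<lambda>a. tensor_GH a b)"
    and mult: "tensor_GH a b * tensor_GH a' b' = tensor_GH (a * a') (b * b')"
    and one: "tensor_GH 1 1 = 1" for a a' b b'
    unfolding cstar_tensor_product_def by simp_all
  have "local_correlation (trace_correlation \<tau> ?W)" if "tracial_state \<tau>" for \<tau>
  proof -
    have \<tau>: "positive_trace \<tau>" "\<tau> 1 = 1" using that by (simp_all add: tracial_state_iff)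
    then have lin: "Vector_Spaces.linear scaleC (*) \<tau>" unfolding positive_trace_def by simp
    interpret \<tau>: Vector_Spaces.linear scaleC "(*)" \<tau> by (fact lin)
    interpret R: Vector_Spaces.linear scaleC scaleC "\<lambda>b. tensor_GH a b" for a by (fact lin_right)
    interpret L: Vector_Spaces.linear scaleC scaleC "\<lambda>a. tensor_GH a b" for b by (fact lin_left)
    \<comment> \<open>The correlation of \<open>?W\<close> with \<open>x\<close> inserted in the
      second leg. It is additive in \<open>x\<close>, so the induction can carry cone membership to
      \<open>x = 1\<close>.\<close>
    let ?p = "\<lambda>x l k i j. \<tau> (tensor_GH (U $ fst i $ fst l * U $ fst j $ fst k)
                (V $ snd i $ snd l * (V $ snd j $ snd k * x)))"
    have "local_cone (?p 1)"
    proof (rule commutative_magic_unitary_induct[OF V, where P = "\<lambda>x. local_cone (?p x)"])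
      show "x * y = y * x" for x y :: 'b using assms(4) by blast
      show "local_cone (?p 0)" by (simp add: R.zero \<tau>.zero local_cone_zero)
      show "local_cone (?p (x + y))" if "local_cone (?p x)" "local_cone (?p y)" for x y
        using local_cone_add[OF that] by (simp add: distrib_left R.add \<tau>.add)
      fix x \<sigma>
      assume x: "star x = x" "x * x = x" and \<sigma>: "bij \<sigma>"
        and V\<sigma>: "\<And>a c. V $ a $ c * x = (if c = \<sigma> a then x else 0)"
      have "local_cone (trace_correlation (\<lambda>a. \<tau> (tensor_GH a x)) U)"
        by (rule positive_trace_local_cone[OF U assms(3) positive_trace_slice[OF t \<tau>(1) x]])
      note local_cone_times_permutation[OF this \<sigma>]
      \<comment> \<open>Applying \<open>V\<sigma>\<close> twice, the two entries of \<open>V\<close>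
        in \<open>?p\<close> turn \<open>x\<close> into \<open>x\<close> or \<open>0\<close>,
        exactly as the correlation of \<open>\<sigma>\<close> prescribes.\<close>
      moreover have "trace_correlation (\<lambda>a. \<tau> (tensor_GH a x)) U (fst l) (fst k) (fst i) (fst j) *
              permutation_correlation \<sigma> (snd l) (snd k) (snd i) (snd j) = ?p x l k i j" for l k i j
        by (simp add: V\<sigma> R.zero \<tau>.zero trace_correlation_def permutation_correlation_def)
      ultimately show "local_cone (?p x)" by simp
    qed
    moreover have "trace_correlation \<tau> ?W = ?p 1"
      by (simp add: trace_correlation_def tensor_representation_def mult fun_eq_iff)
    ultimately have "local_cone (trace_correlation \<tau> ?W)" by simp
    moreover have "(\<Sum>q\<in>UNIV. ?W $ i $ q) = 1" for i
    proof -
      have "(\<Sum>q\<in>UNIV. ?W $ i $ q)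
          = (\<Sum>l\<in>UNIV. \<Sum>c\<in>UNIV. tensor_GH (U $ fst i $ l) (V $ snd i $ c))"
        by (simp add: tensor_representation_def sum.cartesian_product case_prod_beta)
      also have "\<dots> = tensor_GH (\<Sum>l\<in>UNIV. U $ fst i $ l) (\<Sum>c\<in>UNIV. V $ snd i $ c)"
        unfolding L.sum by (simp add: R.sum)
      finally show ?thesis using U V one by (simp add: magic_unitary_def)
    qed
    ultimately show ?thesis
      using sum_trace_correlation[OF lin, of ?W] \<tau>(2)
      \<comment> \<open>Any input pair serves here, since the output sum is
        \<open>\<tau> 1 = 1\<close> for all of them.\<close>
      by (intro local_cone_normalized[of _ undefined undefined]) simp_all
  qed
  then show ?thesis unfolding has_nonlocal_symmetry_def by blast
qed

end
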